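(* Let $\eta=0$, let $N\ge1$ be an integer, $T>0$, and let $V^{N+1}$ be the solution of the $(N+1)$-player Hamilton–Jacobi–Bellman system given in the context. Set $$Y^{N+1}(t, \theta)=V^{N+1}(t,1, \theta)-V^{N+1}(t, 0, \theta)=V^{N+1}(t,1, \theta)-V^{N+1}(t, 1, 1- \theta).$$ Then for all $t\in[0,T]$ and all $\theta \in \{0, \frac{1}{N}, \dots, 1\}$, $$Y^{N+1}(t, \theta) \geq 0 \ \text{ (equivalently } \alpha^{N+1}_*(t,0,\theta)=0)\quad \text{if } \theta \geq \tfrac{1}{2},$$ $$Y^{N+1}(t, \theta) \leq 0 \ \text{ (equivalently } \alpha^{N+1}_*(t, 1, \theta)=0) \quad \text{if } \theta \leq \tfrac{1}{2}.$$
   Context: Consider the symmetric $(N+1)$-player game with state space $\{0,1\}$, running cost $f(i,\theta)=|1-\theta-i|$ (so $f(0,\theta)=1-\theta$, $f(1,\theta)=\theta$), where $\theta\in\{0,\frac1N,\dots,1\}$ is the fraction of the other $N$ players in state $0$, and minimum jump rate $\eta=0$. The value function $V^{N+1}(t,i,\theta)$, $t\in[0,T]$, $i\in\{0,1\}$, of a representative player at the Nash equilibrium satisfies the symmetry $V^{N+1}(t,0,1-\theta)=V^{N+1}(t,1,\theta)$, and $V^{N+1}(\cdot,1,\cdot)$ is the unique solution on $[0,T]$ of the ODE system, for $\theta\in\{0,\frac1N,\dots,1\}$, $$ \begin{aligned} -\frac{d}{dt} V^{N+1}(t,1,\theta) ={}& f(1,\theta)- \frac{(\alpha^{N+1}_*(t,1,\theta))^2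 }{2}\\ &+N(1-\theta)\,\alpha^{N+1}_*(t,1,\theta)\big(V^{N+1}(t,1, \theta +\tfrac{1}{N})-V^{N+1}(t,1,\theta)\big)\\ &+N\theta\, \alpha^{N+1}_*(t,0,\theta-\tfrac{1}{N})\big(V^{N+1}(t,1,\theta-\tfrac{1}{N})-V^{N+1}(t,1,\theta)\big),\\ V^{N+1}(T,1,\theta)={}& 0, \end{aligned} $$ where the optimal control is $$\alpha^{N+1}_*(t, i, \theta)=(V^{N+1}(t,i,\theta)-V^{N+1}(t, 1-i, \theta))_+ ,\qquad (a)_+=\max(a,0).$$ Terms with coefficient $N(1-\theta)=0$ (at $\theta=1$) or $N\theta=0$ (at $\theta=0$) are interpreted as $0$. Existence and uniqueness of the solution on $[0,T]$ may be taken as given. *)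

theory Defs
  imports Complex_Main
begin

(* Player states 0 and 1 are naturals, so 1 - i is the other state. theta is the fraction of
   the other N players that are in state 0. The minimum jump rate eta is 0. *)

definition grid :: "nat \<Rightarrow> real set" where
  "grid N = {real k / real N | k. k \<le> N}"

definition running_cost :: "nat \<Rightarrow> real \<Rightarrow> real" where
  "running_cost i \<theta> = \<bar>1 - \<theta> - real i\<bar>"

definition opt_control :: "(real \<Rightarrow> nat \<Rightarrow> real \<Rightarrow> real) \<Rightarrow> real \<Rightarrow> nat \<Rightarrow> real \<Rightarrow> real" where
  "opt_control V t i \<theta> = max (V t i \<theta> - V t (1 - i) \<theta>) 0"

(* At theta = 1 (resp. theta = 0) the arguments theta + 1/N (resp. theta - 1/N) lie outside the
   grid, where V is unconstrained; the coefficient of the term is 0 there. *)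
definition hjb_rhs :: "nat \<Rightarrow> (real \<Rightarrow> nat \<Rightarrow> real \<Rightarrow> real) \<Rightarrow> real \<Rightarrow> real \<Rightarrow> real" where
  "hjb_rhs N V t \<theta> =
     running_cost 1 \<theta> - (opt_control V t 1 \<theta>)\<^sup>2 / 2
     + real N * (1 - \<theta>) * opt_control V t 1 \<theta> * (V t 1 (\<theta> + 1 / real N) - V t 1 \<theta>)
     + real N * \<theta> * opt_control V t 0 (\<theta> - 1 / real N) * (V t 1 (\<theta> - 1 / real N) - V t 1 \<theta>)"

(* V t i theta is the value function of the (N+1)-player game; derivatives at the endpoints of
   [0,T] are one-sided. *)
definition hjb_solution :: "nat \<Rightarrow> real \<Rightarrow> (real \<Rightarrow> nat \<Rightarrow> real \<Rightarrow> real) \<Rightarrow> bool" where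
  "hjb_solution N T V \<longleftrightarrow>
     (\<forall>t\<in>{0..T}. \<forall>\<theta>\<in>grid N. V t 0 (1 - \<theta>) = V t 1 \<theta>) \<and>
     (\<forall>t\<in>{0..T}. \<forall>\<theta>\<in>grid N.
        ((\<lambda>s. V s 1 \<theta>) has_real_derivative - hjb_rhs N V t \<theta>) (at t within {0..T})) \<and>
     (\<forall>\<theta>\<in>grid N. V T 1 \<theta> = 0)"

definition value_gap :: "(real \<Rightarrow> nat \<Rightarrow> real \<Rightarrow> real) \<Rightarrow> real \<Rightarrow> real \<Rightarrow> real" where
  "value_gap V t \<theta> = V t 1 \<theta> - V t 0 \<theta>"

end

theory Submission
  imports Defs
begin

text \<open>
  Write \<open>v k\<close> for the value in state 1 at \<open>\<theta> = k/N\<close>. Consider jointly the gaps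
  \<open>v k - v (N - k)\<close> for \<open>2 k > N\<close> and the increments \<open>v k - v (k - 1)\<close> for \<open>1 \<le> k\<close>,
  \<open>2 k \<le> N\<close>. All of them vanish at the terminal time. As long as they are all nonnegative, most
  jump rates vanish, and a member of the family that reaches 0 has a strictly negative time
  derivative, because the running cost is strictly increasing in \<open>\<theta>\<close>. Hence, going backwards in
  time, no member of the family can become negative.
\<close>

section \<open>A barrier principle backwards in time\<close>

text \<open>Let \<open>s\<close> be the supremum of the times at which some member is negative. All
  members are nonnegative at \<open>s\<close> and remain so just before it, a contradiction. The
  sign of \<open>D\<close> is demanded only where the whole family is nonnegative, so members may
  control each other's derivatives.\<close>

lemma backward_barrier:
  fixes g D :: "'i \<Rightarrow> real \<Rightarrow> real"
  assumes "finite I"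
    and terminal: "\<And>i. i \<in> I \<Longrightarrow> g i T \<ge> 0"
    and deriv: "\<And>i t. \<lbrakk>i \<in> I; t \<in> {0..T}\<rbrakk> \<Longrightarrow> (g i has_real_derivative D i t) (at t within {0..T})"
    and barrier: "\<And>i t. \<lbrakk>i \<in> I; t \<in> {0..T}; \<forall>j\<in>I. g j t \<ge> 0; g i t = 0\<rbrakk> \<Longrightarrow> D i t < 0"
    and "i \<in> I" "t \<in> {0..T}"
  shows "g i t \<ge> 0"
proof (rule ccontr)
  assume "\<not> g i t \<ge> 0"
  define B where "B = {r \<in> {0..T}. \<exists>j\<in>I. g j r < 0}"
  define s where "s = Sup B"
  have "t \<in> B"
    using \<open>\<not> g i t \<ge> 0\<close> \<open>i \<in> I\<close> \<open>t \<in> {0..T}\<close> by (auto simp: B_def not_le)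
  have bdd: "bdd_above B"
    by (rule bdd_aboveI[of _ T]) (auto simp: B_def)
  have "t \<le> s"
    unfolding s_def using \<open>t \<in> B\<close> bdd by (rule cSup_upper)
  moreover have "s \<le> T"
    unfolding s_def using \<open>t \<in> B\<close> by (intro cSup_least) (auto simp: B_def)
  ultimately have s: "s \<in> {0..T}"
    using \<open>t \<in> {0..T}\<close> by auto
  have cont: "(g j \<longlongrightarrow> g j s) (at s within {0..T})" if "j \<in> I" for j
    using DERIV_continuous[OF deriv[OF that s]] by (simp add: continuous_within)
  have after: "g j r \<ge> 0" if "j \<in> I" "s < r" "r \<le> T" for j r
  proof (rule ccontr)
    assume "\<not> g j r \<ge> 0"
    then have "r \<in> B" using that s by (auto simp: B_def not_le)
    then have "r \<le> s" unfolding s_def using bdd by (rule cSup_upper)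
    then show False using \<open>s < r\<close> by simp
  qed
  \<comment> \<open>For \<open>s < T\<close> the value is a limit from the right of nonnegative
    values; at \<open>s = T\<close> only the terminal condition is available.\<close>
  have nonneg: "g j s \<ge> 0" if j: "j \<in> I" for j
  proof (cases "s = T")
    case True
    then show ?thesis using terminal j by simp
  next
    case False
    then have "s < T" using s by simp
    have "(g j \<longlongrightarrow> g j s) (at s within {s..T})"
      by (rule tendsto_within_subset[OF cont[OF j]]) (use s in auto)
    then have "(g j \<longlongrightarrow> g j s) (at_right s)"
      using \<open>s < T\<close> by (simp add: at_within_Icc_at_right)
    moreover have "\<forall>\<^sub>F r in at_right s. g j r \<ge> 0"
      using eventually_at_right_real[OF \<open>s < T\<close>] by eventually_elim (use after j in auto)
    ultimately show ?thesis
      by (rule tendsto_lowerbound) simp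
  qed
  \<comment> \<open>A member that vanishes at \<open>s\<close> has negative derivative there, hence
    is positive just before; a positive member stays positive by continuity.\<close>
  have before: "\<exists>d>0. \<forall>r. s - d < r \<longrightarrow> r \<le> s \<longrightarrow> r \<in> {0..T} \<longrightarrow> g j r \<ge> 0" if j: "j \<in> I" for j
  proof (cases "g j s = 0")
    case True
    then have "D j s < 0" using barrier[OF j s] nonneg by blast
    from has_real_derivative_neg_dec_left[OF deriv[OF j s] this]
    obtain d where d: "d > 0" "\<And>h. \<lbrakk>0 < h; s - h \<in> {0..T}; h < d\<rbrakk> \<Longrightarrow> g j s < g j (s - h)"
      by blast
    have "g j r \<ge> 0" if "s - d < r" "r \<le> s" "r \<in> {0..T}" for r
      using d(2)[of "s - r"] that True by (cases "r = s") auto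
    then show ?thesis using d(1) by blast
  next
    case False
    then have "g j s > 0" using nonneg[OF j] by simp
    then have "\<forall>\<^sub>F r in at s within {0..T}. g j r > 0"
      using cont[OF j] by (intro order_tendstoD)
    then obtain d where d: "d > 0" "\<And>r. \<lbrakk>r \<in> {0..T}; r \<noteq> s; dist r s < d\<rbrakk> \<Longrightarrow> g j r > 0"
      unfolding eventually_at by blast
    have "g j r \<ge> 0" if "s - d < r" "r \<le> s" "r \<in> {0..T}" for r
      using d(2)[of r] that \<open>g j s > 0\<close> by (cases "r = s") (auto simp: dist_real_def)
    then show ?thesis using d(1) by blast
  qed
  then obtain d where d: "\<And>j. j \<in> I \<Longrightarrow> d j > 0"
    "\<And>j r. \<lbrakk>j \<in> I; s - d j < r; r \<le> s; r \<in> {0..T}\<rbrakk> \<Longrightarrow> g j r \<ge> 0"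
    by metis
  \<comment> \<open>Finiteness of the family gives one interval to the left of \<open>s\<close> that
    is free of points of \<open>B\<close>, against the choice of \<open>s\<close> as
    supremum.\<close>
  define \<delta> where "\<delta> = Min (d ` I)"
  have \<delta>: "\<delta> \<le> d j" if "j \<in> I" for j
    unfolding \<delta>_def using \<open>finite I\<close> that by simp
  have "\<delta> \<in> d ` I"
    unfolding \<delta>_def using \<open>finite I\<close> \<open>i \<in> I\<close> by (intro Min_in) auto
  then have "\<delta> > 0" using d(1) by auto
  then obtain r where r: "r \<in> B" "s - \<delta> < r"
    using less_cSupD[of B "s - \<delta>"] \<open>t \<in> B\<close> by (auto simp: s_def)
  then obtain j where j: "j \<in> I" "g j r < 0" "r \<in> {0..T}"
    by (auto simp: B_def)
  have "r \<le> s"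
    unfolding s_def using r(1) bdd by (rule cSup_upper)
  moreover have "s - d j < r"
    using \<delta>[OF j(1)] r(2) by simp
  ultimately show False
    using d(2)[of j r] j by simp
qed

section \<open>Signs of the right-hand side on the family\<close>

text \<open>The right-hand side \<open>hjb_rhs\<close> at \<open>\<theta> = k/N\<close>. The junk value \<open>v (0 - 1) = v 0\<close> only
  occurs with coefficient 0.\<close>

definition grid_rhs :: "nat \<Rightarrow> (nat \<Rightarrow> real) \<Rightarrow> nat \<Rightarrow> real" where
  "grid_rhs N v k =
     real k / real N - (max (v k - v (N - k)) 0)\<^sup>2 / 2
     + real (N - k) * max (v k - v (N - k)) 0 * (v (k + 1) - v k)
     + real k * max (v (N - (k - 1)) - v (k - 1)) 0 * (v (k - 1) - v k)"

text \<open>The midpoint gap \<open>2 * k = N\<close> is left out: it is identically 0, so its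
  derivative could never be strictly negative. The expression is linear in \<open>v\<close>, so
  applying it to \<open>grid_rhs N v\<close> gives minus the time derivative of the member.\<close>

definition gap_or_increment :: "nat \<Rightarrow> (nat \<Rightarrow> real) \<Rightarrow> nat \<Rightarrow> real" where
  "gap_or_increment N v k = (if 2 * k > N then v k - v (N - k) else v k - v (k - 1))"

lemma gap_nonneg_if_family_nonneg:
  assumes "\<forall>j\<in>{1..N}. gap_or_increment N v j \<ge> 0" and "N \<le> 2 * k" "k \<le> N"
  shows "v (N - k) \<le> v k"
proof (cases "N = 2 * k")
  case False
  then have "2 * k > N" "k \<in> {1..N}" using assms by auto
  with assms(1) show ?thesis by (auto simp: gap_or_increment_def dest: bspec[of _ _ k])
qed simp

text \<open>Below one half the gap is nonpositive, so the control in state 1 vanishes; the quadratic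
  term and the upward jump disappear with it.\<close>

lemma grid_rhs_below_half:
  assumes "\<forall>j\<in>{1..N}. gap_or_increment N v j \<ge> 0" and "2 * k \<le> N"
  shows "grid_rhs N v k =
    real k / real N + real k * max (v (N - (k - 1)) - v (k - 1)) 0 * (v (k - 1) - v k)"
proof -
  have "v k \<le> v (N - k)"
    using gap_nonneg_if_family_nonneg[OF assms(1), of "N - k"] assms(2) by simp
  then show ?thesis by (simp add: grid_rhs_def)
qed

text \<open>This is what the increments are for: they make the remaining downward jump term
  nonpositive.\<close>

lemma grid_rhs_below_half_le:
  assumes "\<forall>j\<in>{1..N}. gap_or_increment N v j \<ge> 0" and "2 * k \<le> N"
  shows "grid_rhs N v k \<le> real k / real N"
proof (cases "k = 0")
  case False
  then have "v (k - 1) - v k \<le> 0"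
    using assms by (auto simp: gap_or_increment_def dest: bspec[of _ _ k])
  then have "real k * max (v (N - (k - 1)) - v (k - 1)) 0 * (v (k - 1) - v k) \<le> 0"
    by (intro mult_nonneg_nonpos) auto
  then show ?thesis using grid_rhs_below_half[OF assms] by simp
qed (use grid_rhs_below_half[OF assms] in simp)

text \<open>The player's own control is 0 by \<open>v k = v (N - k)\<close>; it remains to see that
  the rate of the downward jump vanishes too.\<close>

lemma grid_rhs_at_vanishing_gap:
  assumes "\<forall>j\<in>{1..N}. gap_or_increment N v j \<ge> 0"
    and "2 * k > N" "k \<le> N" "v k = v (N - k)"
  shows "grid_rhs N v k = real k / real N"
proof -
  have "v (N - (k - 1)) \<le> v (k - 1)"
  proof (cases "N \<le> 2 * (k - 1)")
    case True
    then show ?thesis using gap_nonneg_if_family_nonneg[OF assms(1), of "k - 1"] assms by simp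
  next
    \<comment> \<open>Here \<open>N = 2 * k - 1\<close>: the point below \<open>k\<close> is its
      mirror image, so the vanishing gap itself gives the claim.\<close>
    case False
    then have "N - (k - 1) = k" "N - k = k - 1" using assms by auto
    then show ?thesis using assms by simp
  qed
  then show ?thesis using assms(4) by (simp add: grid_rhs_def)
qed

text \<open>At a zero, the upper point of the pair contributes exactly its running cost and the
  lower one at most its own, which is strictly smaller.\<close>

lemma family_member_pushed_up:
  assumes nonneg: "\<forall>j\<in>{1..N}. gap_or_increment N v j \<ge> 0"
    and k: "k \<in> {1..N}" and zero: "gap_or_increment N v k = 0"
  shows "gap_or_increment N (grid_rhs N v) k > 0"
proof (cases "2 * k > N")
  case True
  then have "grid_rhs N v k = real k / real N"
    using grid_rhs_at_vanishing_gap[OF nonneg] k zero by (simp add: gap_or_increment_def)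
  moreover have "grid_rhs N v (N - k) \<le> real (N - k) / real N"
    using grid_rhs_below_half_le[OF nonneg] True by simp
  moreover have "real (N - k) / real N < real k / real N"
    using True k by (intro divide_strict_right_mono) auto
  ultimately show ?thesis using True by (simp add: gap_or_increment_def)
next
  case False
  then have "v k = v (k - 1)" using zero by (simp add: gap_or_increment_def)
  then have "grid_rhs N v k = real k / real N"
    using grid_rhs_below_half[OF nonneg] False by simp
  moreover have "grid_rhs N v (k - 1) \<le> real (k - 1) / real N"
    using grid_rhs_below_half_le[OF nonneg] False by simp
  moreover have "real (k - 1) / real N < real k / real N"
    using k by (intro divide_strict_right_mono) auto
  ultimately show ?thesis using False by (simp add: gap_or_increment_def)
qed

section \<open>From the game to grid indices\<close>

lemma one_minus_grid_point:
  assumes "N \<ge> 1" "k \<le> N"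
  shows "1 - real k / real N = real (N - k) / real N"
  using assms by (simp add: field_simps of_nat_diff)

lemma grid_point_in_grid: "k \<le> N \<Longrightarrow> real k / real N \<in> grid N"
  by (auto simp: grid_def)

lemma value_state_0:
  assumes "N \<ge> 1" "hjb_solution N T V" "t \<in> {0..T}" "k \<le> N"
  shows "V t 0 (real k / real N) = V t 1 (real (N - k) / real N)"
proof -
  have "V t 0 (1 - real (N - k) / real N) = V t 1 (real (N - k) / real N)"
    using assms grid_point_in_grid[of "N - k" N] by (auto simp: hjb_solution_def)
  then show ?thesis using one_minus_grid_point[of N "N - k"] assms by simp
qed

lemma hjb_rhs_on_grid:
  assumes "N \<ge> 1" "hjb_solution N T V" "t \<in> {0..T}" "k \<le> N"
  shows "hjb_rhs N V t (real k / real N) = grid_rhs N (\<lambda>j. V t 1 (real j / real N)) k"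
proof -
  have cost: "running_cost 1 (real k / real N) = real k / real N"
    by (simp add: running_cost_def)
  \<comment> \<open>For \<open>k = N\<close> both sides name the same point off the grid, so the
    upward terms match without a separate case.\<close>
  have up: "real k / real N + 1 / real N = real (k + 1) / real N"
    by (simp add: add_divide_distrib)
  have coeff: "real N * (1 - real k / real N) = real (N - k)" "real N * (real k / real N) = real k"
    using assms by (simp_all add: field_simps of_nat_diff)
  have down: "real k / real N - 1 / real N = real (k - 1) / real N" if "k \<noteq> 0"
    using that by (simp add: diff_divide_distrib of_nat_diff)
  have ctrl1: "opt_control V t 1 (real k / real N)
      = max (V t 1 (real k / real N) - V t 1 (real (N - k) / real N)) 0"
    using value_state_0[OF assms] by (simp add: opt_control_def)
  have ctrl0: "opt_control V t 0 (real (k - 1) / real N)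
      = max (V t 1 (real (N - (k - 1)) / real N) - V t 1 (real (k - 1) / real N)) 0"
    using value_state_0[OF assms(1-3), of "k - 1"] assms(4) by (simp add: opt_control_def)
  show ?thesis
  \<comment> \<open>For \<open>k = 0\<close> truncated subtraction breaks \<open>down\<close>:
    \<open>hjb_rhs\<close> looks at -1/N and \<open>grid_rhs\<close> at 0, but both terms have
    coefficient 0.\<close>
  proof (cases "k = 0")
    case True
    then show ?thesis
      unfolding hjb_rhs_def grid_rhs_def cost coeff up ctrl1 by simp
  next
    case False
    then show ?thesis
      unfolding hjb_rhs_def grid_rhs_def cost coeff up ctrl1 down[OF False] ctrl0 by simp
  qed
qed

lemma gap_nonneg_above_half:
  assumes N: "N \<ge> 1" and sol: "hjb_solution N T V" and t: "t \<in> {0..T}"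
    and k: "k \<le> N" "N \<le> 2 * k"
  shows "V t 1 (real (N - k) / real N) \<le> V t 1 (real k / real N)"
proof -
  define v where "v = (\<lambda>s j. V s 1 (real j / real N))"
  have v_deriv: "((\<lambda>s. v s j) has_real_derivative - grid_rhs N (v s) j) (at s within {0..T})"
    if "s \<in> {0..T}" "j \<le> N" for s j
    using sol that grid_point_in_grid[of j N] hjb_rhs_on_grid[OF N sol that]
    unfolding hjb_solution_def v_def by metis
  have terminal: "v T j = 0" if "j \<le> N" for j
    using sol grid_point_in_grid[OF that] by (simp add: hjb_solution_def v_def)
  \<comment> \<open>The minus sign in \<open>D\<close> comes from the backward equation, whose
    right-hand side is minus the time derivative.\<close>
  have "gap_or_increment N (v t) j \<ge> 0" if "j \<in> {1..N}" for j
  proof (rule backward_barrier[where I = "{1..N}" and g = "\<lambda>i s. gap_or_increment N (v s) i"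
        and D = "\<lambda>i s. - gap_or_increment N (grid_rhs N (v s)) i"])
    fix i s
    assume i: "i \<in> {1..N}" and s: "s \<in> {0..T}"
    show "((\<lambda>s. gap_or_increment N (v s) i) has_real_derivative
        - gap_or_increment N (grid_rhs N (v s)) i) (at s within {0..T})"
    proof (cases "2 * i > N")
      case True
      then show ?thesis
        using DERIV_diff[OF v_deriv[OF s, of i] v_deriv[OF s, of "N - i"]] i
        by (simp add: gap_or_increment_def)
    next
      case False
      then show ?thesis
        using DERIV_diff[OF v_deriv[OF s, of i] v_deriv[OF s, of "i - 1"]] i
        by (simp add: gap_or_increment_def)
    qed
    assume "\<forall>j\<in>{1..N}. gap_or_increment N (v s) j \<ge> 0" "gap_or_increment N (v s) i = 0"
    then show "- gap_or_increment N (grid_rhs N (v s)) i < 0"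
      using family_member_pushed_up i by simp
  qed (use that t terminal in \<open>auto simp: gap_or_increment_def\<close>)
  then show ?thesis
    using gap_nonneg_if_family_nonneg[of N "v t" k] k by (simp add: v_def)
qed

theorem proposition5p1:
  fixes N :: nat and T :: real and V :: "real \<Rightarrow> nat \<Rightarrow> real \<Rightarrow> real"
  assumes "N \<ge> 1" and "T > 0" and "hjb_solution N T V"
  shows "\<forall>t\<in>{0..T}. \<forall>\<theta>\<in>grid N.
           value_gap V t \<theta> = V t 1 \<theta> - V t 1 (1 - \<theta>) \<and>
           (value_gap V t \<theta> \<ge> 0 \<longleftrightarrow> opt_control V t 0 \<theta> = 0) \<and>
           (value_gap V t \<theta> \<le> 0 \<longleftrightarrow> opt_control V t 1 \<theta> = 0) \<and>
           (\<theta> \<ge> 1 / 2 \<longrightarrow> value_gap V t \<theta> \<ge> 0 \<and> opt_control V t 0 \<theta> = 0) \<and>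
           (\<theta> \<le> 1 / 2 \<longrightarrow> value_gap V t \<theta> \<le> 0 \<and> opt_control V t 1 \<theta> = 0)"
proof (intro ballI)
  fix t \<theta>
  assume t: "t \<in> {0..T}" and "\<theta> \<in> grid N"
  then obtain k where k: "k \<le> N" and \<theta>: "\<theta> = real k / real N"
    by (auto simp: grid_def)
  have gap: "value_gap V t \<theta> = V t 1 \<theta> - V t 1 (1 - \<theta>)"
    using value_state_0[OF assms(1,3) t k] one_minus_grid_point[OF assms(1) k]
    by (simp add: value_gap_def \<theta>)
  have ctrl0: "value_gap V t \<theta> \<ge> 0 \<longleftrightarrow> opt_control V t 0 \<theta> = 0"
    and ctrl1: "value_gap V t \<theta> \<le> 0 \<longleftrightarrow> opt_control V t 1 \<theta> = 0"
    by (auto simp: value_gap_def opt_control_def max_def)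
  have above: "value_gap V t \<theta> \<ge> 0" if "\<theta> \<ge> 1 / 2"
  proof -
    have "real N \<le> real (2 * k)" using that assms(1) by (simp add: \<theta> field_simps)
    then have "N \<le> 2 * k" by linarith
    then show ?thesis
      using gap_nonneg_above_half[OF assms(1,3) t k] gap one_minus_grid_point[OF assms(1) k]
      by (simp add: \<theta>)
  qed
  have below: "value_gap V t \<theta> \<le> 0" if "\<theta> \<le> 1 / 2"
  proof -
    have "real (2 * k) \<le> real N" using that assms(1) by (simp add: \<theta> field_simps)
    then have "2 * k \<le> N" by linarith
    \<comment> \<open>Reflection: the upper-half result at \<open>N - k\<close> compares the same
      two values with their roles exchanged.\<close>
    then show ?thesis
      using gap_nonneg_above_half[OF assms(1,3) t, of "N - k"] k gap
        one_minus_grid_point[OF assms(1) k]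
      by (simp add: \<theta>)
  qed
  show "value_gap V t \<theta> = V t 1 \<theta> - V t 1 (1 - \<theta>) \<and>
           (value_gap V t \<theta> \<ge> 0 \<longleftrightarrow> opt_control V t 0 \<theta> = 0) \<and>
           (value_gap V t \<theta> \<le> 0 \<longleftrightarrow> opt_control V t 1 \<theta> = 0) \<and>
           (\<theta> \<ge> 1 / 2 \<longrightarrow> value_gap V t \<theta> \<ge> 0 \<and> opt_control V t 0 \<theta> = 0) \<and>
           (\<theta> \<le> 1 / 2 \<longrightarrow> value_gap V t \<theta> \<le> 0 \<and> opt_control V t 1 \<theta> = 0)"
    using gap ctrl0 ctrl1 above below by blast
qed

end
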